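(* Let $A=(a_{ij})\in\mathbb{Z}^{d\times n}$ be a configuration with pairwise distinct columns. Suppose that for each $1\le i\le d$ there exists $z_i\in\mathbb{Z}$ such that $z_i-1\le a_{ij}\le z_i+1$ for all $1\le j\le n$. Then any quadratic binomial in $I_A$ belongs to $C_A^{\mathrm{sf}}$. Moreover, if for each $1\le i\le d$ there exists $z_i\in\mathbb{Z}$ such that $z_i\le a_{ij}\le z_i+1$ for all $1\le j\le n$, then any quadratic binomial in $I_A$ belongs to $C_A^{\mathrm{sfsf}}$.
   Context: A configuration of $\mathbb{R}^d$ is a matrix $A\in\mathbb{Z}^{d\times n}$ with columns $\mathbf{a}_1,\dots,\mathbf{a}_n$ such that some hyperplane of $\mathbb{R}^d$ not passing through the origin contains every $\mathbf{a}_j$. Let $K$ be a field. The toric ring $K[A]$ is the $K$-subalgebra of $K[t_1^{\pm1},\dots,t_d^{\pm1}]$ generated by the Laurent monomials $T^{\mathbf{a}_j}=t_1^{a_{1j}}\cdots t_d^{a_{dj}}$. The toric ideal $I_A$ is the kernel of the $K$-algebra map $\pi:K[X]=K[x_1,\dots,x_n]\to K[A]$, $x_j\mapsto T^{\mathbf{a}_j}$. A binomial is a difference $u-v$ of two distinct monomials; it is quadratic if both monomials have degree 2. The support of a monomial $u$ is $\mathrm{supp}(u)=\{x_i : x_i \mid u\}$, and $\mathrm{supp}(u-v)=\mathrm{supp}(u)\cup\mathrm{supp}(v)$. An irreducible binomial $f\in I_A$ is a circuit of $I_A$ if there is no binomial $g\in I_A$ with $\mathrm{supp}(g)\subsetneq\mathrm{supp}(f)$.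 $C_A$ denotes the set of circuits of $I_A$; $C_A^{\mathrm{sf}}$ is the set of circuits $u-v\in C_A$ such that at least one of $u,v$ is squarefree; $C_A^{\mathrm{sfsf}}$ is the set of circuits $u-v\in C_A$ such that both $u$ and $v$ are squarefree. *)

theory Defs
  imports
    "HOL-Analysis.Analysis"
    "HOL-Library.Poly_Mapping"
    "HOL-Computational_Algebra.Factorial_Ring"
begin

section \<open>Polynomials and Laurent polynomials\<close>

text \<open>
  A monomial in the variables indexed by \<open>'n\<close> is identified with its exponent vector, of type
  \<open>'n \<Rightarrow>\<^sub>0 nat\<close>; a Laurent monomial in the variables indexed by \<open>'d\<close> with its exponent vector,
  of type \<open>int ^ 'd\<close>. The (Laurent) polynomial ring is then the ring of finitely supported
  coefficient functions on exponent vectors, with the convolution product of \<open>Poly_Mapping\<close>.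
\<close>

type_synonym ('n, 'k) mpoly = "('n \<Rightarrow>\<^sub>0 nat) \<Rightarrow>\<^sub>0 'k"

type_synonym ('d, 'k) laurent = "(int ^ 'd) \<Rightarrow>\<^sub>0 'k"

definition mon :: "('n \<Rightarrow>\<^sub>0 nat) \<Rightarrow> ('n, 'k::field) mpoly" where
  "mon u = Poly_Mapping.single u 1"

definition mvar :: "'n \<Rightarrow> ('n, 'k::field) mpoly" where
  "mvar j = mon (Poly_Mapping.single j 1)"

definition lmon :: "int ^ 'd \<Rightarrow> ('d::finite, 'k::field) laurent" where
  "lmon a = Poly_Mapping.single a 1"

lemma lmon_zero: "lmon 0 = 1"
  by (simp add: lmon_def)

lemma lmon_add: "lmon (a + b) = lmon a * lmon b"
  by (simp add: lmon_def mult_single)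


section \<open>Configurations, toric rings and toric ideals\<close>

text \<open>
  A \<open>d \<times> n\<close> integer matrix has type \<open>int ^ 'n ^ 'd\<close>, so that \<open>A $ i $ j\<close> is the entry in row
  \<open>i\<close> and column \<open>j\<close>.
\<close>

definition configuration :: "int ^ 'n ^ 'd \<Rightarrow> bool" where
  "configuration A \<longleftrightarrow>
     (\<exists>(w :: real ^ 'd) c. w \<noteq> 0 \<and> 0 \<notin> {x. w \<bullet> x = c} \<and>
        (\<forall>j. (\<chi> i. real_of_int (A $ i $ j)) \<in> {x. w \<bullet> x = c}))"

definition subalgebra :: "('d::finite, 'k::field) laurent set \<Rightarrow> bool" where
  "subalgebra S \<longleftrightarrow> (\<forall>c. Poly_Mapping.single 0 c \<in> S) \<and>
     (\<forall>f\<in>S. \<forall>g\<in>S. f + g \<in> S \<and> f * g \<in> S)"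

definition toric_ring :: "int ^ 'n ^ 'd \<Rightarrow> ('d::finite, 'k::field) laurent set" where
  "toric_ring A = \<Inter>{S. subalgebra S \<and> (\<forall>j. lmon (column j A) \<in> S)}"

definition toric_map :: "int ^ 'n ^ 'd::finite \<Rightarrow> ('n::finite, 'k::field) mpoly \<Rightarrow> ('d, 'k) laurent" where
  "toric_map A f =
     (\<Sum>m\<in>Poly_Mapping.keys f. Poly_Mapping.single 0 (Poly_Mapping.lookup f m) *
        (\<Prod>j\<in>UNIV. lmon (column j A) ^ Poly_Mapping.lookup m j))"

definition toric_ideal :: "int ^ 'n ^ 'd::finite \<Rightarrow> ('n::finite, 'k::field) mpoly set" where
  "toric_ideal A = {f. toric_map A f = 0}"

text \<open>
  The map \<open>toric_map A\<close> is the \<open>K\<close>-algebra map sending each variable to the corresponding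
  Laurent monomial, and its image is the toric ring.
\<close>

lemma toric_map_add: "toric_map A (f + g) = toric_map A f + toric_map A g"
  unfolding toric_map_def
  by (rule setsum_keys_plus_distrib) (simp_all add: single_add algebra_simps)

lemma toric_map_single:
  "toric_map A (Poly_Mapping.single m c) =
     Poly_Mapping.single 0 c * (\<Prod>j\<in>UNIV. lmon (column j A) ^ Poly_Mapping.lookup m j)"
  by (simp add: toric_map_def)

lemma toric_map_const: "toric_map A (Poly_Mapping.single 0 c) = Poly_Mapping.single 0 c"
  by (simp add: toric_map_single)

lemma toric_map_mvar:
  fixes A :: "int ^ 'n ^ 'd::finite"
  shows "toric_map A (mvar j) = (lmon (column j A) :: ('d, 'k::field) laurent)"
proof -
  have "(\<Prod>i\<in>UNIV. lmon (column i A) ^ Poly_Mapping.lookup (Poly_Mapping.single j (1::nat)) i) =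
        (\<Prod>i\<in>UNIV. if i = j then (lmon (column i A) :: ('d, 'k) laurent) else 1)"
    by (rule prod.cong) (auto simp: lookup_single)
  then show ?thesis
    by (simp add: mvar_def mon_def toric_map_single)
qed

lemma mpoly_induct [case_names zero single_add]:
  fixes f :: "('n, 'k::field) mpoly"
  assumes "P 0" and "\<And>m c f. P f \<Longrightarrow> P (Poly_Mapping.single m c + f)"
  shows "P f"
proof (induction f rule: update_induct)
  case const
  show ?case by (rule assms(1))
next
  case (update f a b)
  have "Poly_Mapping.update a b f = Poly_Mapping.single a b + f"
    using update(1)
    by (intro poly_mapping_eqI) (auto simp: lookup_add lookup_single lookup_update in_keys_iff)
  then show ?case using assms(2) update by simp
qed

lemma toric_map_mult:
  fixes A :: "int ^ 'n ^ 'd::finite" and f g :: "('n, 'k::field) mpoly"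
  shows "toric_map A (f * g) = toric_map A f * toric_map A g"
proof (induction f rule: mpoly_induct)
  case zero
  then show ?case by (simp add: toric_map_def)
next
  case (single_add m c f)
  have "toric_map A (Poly_Mapping.single m c * g) =
        toric_map A (Poly_Mapping.single m c) * toric_map A g"
  proof (induction g rule: mpoly_induct)
    case zero
    then show ?case by (simp add: toric_map_def)
  next
    case (single_add m' c' g)
    have "toric_map A (Poly_Mapping.single m c * Poly_Mapping.single m' c') =
        toric_map A (Poly_Mapping.single m c) * toric_map A (Poly_Mapping.single m' c')"
    proof -
      have "Poly_Mapping.single (0 :: int ^ 'd) (c * c') =
          Poly_Mapping.single 0 c * Poly_Mapping.single 0 c'"
        by (simp add: mult_single)
      then show ?thesis
        by (simp only: mult_single[of m c m' c'] toric_map_single lookup_add power_add prod.distrib)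
          (simp only: ac_simps)
    qed
    then show ?case
      using single_add by (simp add: distrib_left toric_map_add)
  qed
  then show ?case
    using single_add by (simp add: distrib_right toric_map_add)
qed

lemma range_toric_map: "range (toric_map A) = toric_ring A"
proof
  have "toric_map A f \<in> S" if "subalgebra S" "\<forall>j. lmon (column j A) \<in> S" for S f
  proof -
    have const: "Poly_Mapping.single 0 c \<in> S" for c
      using that by (auto simp: subalgebra_def)
    have one: "1 \<in> S" and zero: "0 \<in> S"
      using const[of 1] const[of 0] by simp_all
    have add: "f + g \<in> S" and mult: "f * g \<in> S" if "f \<in> S" "g \<in> S" for f g
      using that \<open>subalgebra S\<close> by (auto simp: subalgebra_def)
    have pow: "lmon (column j A) ^ k \<in> S" for j k
      by (induction k) (auto intro: one mult simp: that(2))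
    have prd: "(\<Prod>j\<in>J. lmon (column j A) ^ e j) \<in> S" if "finite J" for J e
      using that by (induction J rule: finite_induct) (auto intro: one mult pow)
    show "toric_map A f \<in> S"
      by (induction f rule: mpoly_induct)
        (auto intro!: add mult const prd simp: zero toric_map_add toric_map_single toric_map_def[of _ 0])
  qed
  then show "range (toric_map A) \<subseteq> toric_ring A"
    by (auto simp: toric_ring_def)
next
  have "subalgebra (range (toric_map A))"
    unfolding subalgebra_def
    by (auto simp flip: toric_map_add toric_map_mult) (metis rangeI toric_map_const)
  moreover have "\<forall>j. lmon (column j A) \<in> range (toric_map A)"
    by (metis rangeI toric_map_mvar)
  ultimately show "toric_ring A \<subseteq> range (toric_map A)"
    by (auto simp: toric_ring_def)
qed


section \<open>Binomials and circuits\<close>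

definition is_binomial :: "('n, 'k::field) mpoly \<Rightarrow> bool" where
  "is_binomial f \<longleftrightarrow> (\<exists>u v. u \<noteq> v \<and> f = mon u - mon v)"

definition mon_degree :: "('n::finite \<Rightarrow>\<^sub>0 nat) \<Rightarrow> nat" where
  "mon_degree u = (\<Sum>j\<in>UNIV. Poly_Mapping.lookup u j)"

definition quadratic_binomial :: "('n::finite, 'k::field) mpoly \<Rightarrow> bool" where
  "quadratic_binomial f \<longleftrightarrow>
     (\<exists>u v. u \<noteq> v \<and> mon_degree u = 2 \<and> mon_degree v = 2 \<and> f = mon u - mon v)"

definition squarefree_mon :: "('n \<Rightarrow>\<^sub>0 nat) \<Rightarrow> bool" where
  "squarefree_mon u \<longleftrightarrow> (\<forall>j. Poly_Mapping.lookup u j \<le> 1)"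

text \<open>
  The variables dividing a monomial \<open>u\<close> are the indices in \<open>keys u\<close>. The support of a polynomial
  collects the variables of all its monomials; on binomials this is the union of the supports
  of the two monomials, see \<open>supp_binomial\<close>.
\<close>

definition supp :: "('n, 'k::field) mpoly \<Rightarrow> 'n set" where
  "supp f = (\<Union>u\<in>Poly_Mapping.keys f. Poly_Mapping.keys u)"

lemma supp_binomial:
  assumes "u \<noteq> v"
  shows "supp (mon u - mon v :: ('n, 'k::field) mpoly) = Poly_Mapping.keys u \<union> Poly_Mapping.keys v"
proof -
  have "Poly_Mapping.keys (mon u - mon v :: ('n, 'k) mpoly) = {u, v}"
    using assms by (auto simp: in_keys_iff lookup_minus mon_def lookup_single when_def split: if_splits)
  then show ?thesis by (simp add: supp_def)
qed

definition circuits :: "int ^ 'n ^ 'd::finite \<Rightarrow> ('n::finite, 'k::field) mpoly set" where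
  "circuits A = {f \<in> toric_ideal A. is_binomial f \<and> irreducible f \<and>
     \<not> (\<exists>g\<in>toric_ideal A :: ('n, 'k) mpoly set. is_binomial g \<and> supp g \<subset> supp f)}"

definition circuits_sf :: "int ^ 'n ^ 'd::finite \<Rightarrow> ('n::finite, 'k::field) mpoly set" where
  "circuits_sf A = {f \<in> circuits A.
     \<exists>u v. u \<noteq> v \<and> f = mon u - mon v \<and> (squarefree_mon u \<or> squarefree_mon v)}"

definition circuits_sfsf :: "int ^ 'n ^ 'd::finite \<Rightarrow> ('n::finite, 'k::field) mpoly set" where
  "circuits_sfsf A = {f \<in> circuits A.
     \<exists>u v. u \<noteq> v \<and> f = mon u - mon v \<and> squarefree_mon u \<and> squarefree_mon v}"

end

theory Submission
  imports Defs
begin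

text \<open>
  A quadratic binomial of the toric ideal is \<open>x_i x_j - x_k x_l\<close> with \<open>a_i + a_j = a_k + a_l\<close>;
  since the columns are distinct, the two monomials are coprime and not both squares. Such a
  binomial is irreducible: its factors are homogeneous, and a product of two linear forms cannot
  have these coefficients. A binomial of the ideal with smaller support would give an affine
  dependency between at most three of the columns involved. Distinct columns exclude a dependency
  between two. A dependency between three places all four columns on a line, and then a row that is
  not constant on the line takes four distinct values there, whereas only three are available. In the
  second case a square is impossible, because \<open>2 a_i = a_k + a_l\<close> forces \<open>a_i = a_k\<close> when each
  row takes only two consecutive values.
\<close>

section \<open>Extreme monomials of a product\<close>

lemma lookup_mult_keys:
  fixes f g :: "'a::monoid_add \<Rightarrow>\<^sub>0 'b::semiring_0"
  shows "Poly_Mapping.lookup (f * g) k =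
    (\<Sum>a\<in>Poly_Mapping.keys f. \<Sum>b\<in>Poly_Mapping.keys g. Poly_Mapping.lookup f a * Poly_Mapping.lookup g b when a + b = k)"
proof -
  have "Poly_Mapping.lookup (f * g) k = (\<Sum>a\<in>Poly_Mapping.keys f. Poly_Mapping.lookup f a * (\<Sum>b. Poly_Mapping.lookup g b when k = a + b))"
    unfolding lookup_mult
    by (rule Sum_any.expand_superset) (auto simp: in_keys_iff)
  also have "\<dots> = (\<Sum>a\<in>Poly_Mapping.keys f. Poly_Mapping.lookup f a * (\<Sum>b\<in>Poly_Mapping.keys g. Poly_Mapping.lookup g b when k = a + b))"
    by (intro sum.cong refl arg_cong2[where f="(*)"] Sum_any.expand_superset)
      (auto simp: in_keys_iff)
  finally show ?thesis
    by (simp add: sum_distrib_left mult_when eq_commute[of k])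
qed

text \<open>When \<open>m + n\<close> arises from only one pair of keys, nothing can cancel: its
  coefficient is the product of two nonzero coefficients.\<close>

lemma add_in_keys_mult:
  fixes f g :: "'a::monoid_add \<Rightarrow>\<^sub>0 'b::semiring_no_zero_divisors"
  assumes "m \<in> Poly_Mapping.keys f" "n \<in> Poly_Mapping.keys g"
    and uniq: "\<And>a b. a \<in> Poly_Mapping.keys f \<Longrightarrow> b \<in> Poly_Mapping.keys g \<Longrightarrow> a + b = m + n \<Longrightarrow> a = m \<and> b = n"
  shows "m + n \<in> Poly_Mapping.keys (f * g)"
proof -
  have "Poly_Mapping.lookup (f * g) (m + n) =
      (\<Sum>a\<in>Poly_Mapping.keys f. \<Sum>b\<in>Poly_Mapping.keys g. if b = n then (if a = m then Poly_Mapping.lookup f m * Poly_Mapping.lookup g n else 0) else 0)"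
    unfolding lookup_mult_keys
    by (intro sum.cong refl) (use uniq in \<open>auto simp: when_def\<close>)
  also have "\<dots> = Poly_Mapping.lookup f m * Poly_Mapping.lookup g n"
    using assms(1,2) by simp
  finally show ?thesis
    using assms(1,2) by (simp add: in_keys_iff)
qed

lemma ordered_extreme_key:
  fixes h :: "'a \<Rightarrow> 'o::linorder"
  assumes "f \<noteq> (0 :: 'a \<Rightarrow>\<^sub>0 'b::zero)"
  obtains m n where "m \<in> Poly_Mapping.keys f" "n \<in> Poly_Mapping.keys f" "\<And>a. a \<in> Poly_Mapping.keys f \<Longrightarrow> h m \<le> h a \<and> h a \<le> h n"
proof -
  have "h ` Poly_Mapping.keys f \<noteq> {}" "finite (h ` Poly_Mapping.keys f)"
    using assms by auto
  then have "Min (h ` Poly_Mapping.keys f) \<in> h ` Poly_Mapping.keys f" "Max (h ` Poly_Mapping.keys f) \<in> h ` Poly_Mapping.keys f"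
    by (rule Min_in[rotated] Max_in[rotated]; assumption)+
  then obtain m n where "m \<in> Poly_Mapping.keys f" "n \<in> Poly_Mapping.keys f" "h m = Min (h ` Poly_Mapping.keys f)" "h n = Max (h ` Poly_Mapping.keys f)"
    by force
  then show thesis
    by (intro that[of m n]) auto
qed

text \<open>In a cancellative ordered semigroup the sum of two maxima is reached by no other pair,
  and likewise for minima. The exponents need no order of their own: \<open>h\<close> supplies one,
  and injectivity of \<open>h\<close> carries the uniqueness back to the exponents.\<close>

lemma keys_mult_extreme:
  fixes f g :: "'a::monoid_add \<Rightarrow>\<^sub>0 'b::semiring_no_zero_divisors"
    and h :: "'a \<Rightarrow> 'o::linordered_cancel_ab_semigroup_add"
  assumes add: "\<And>a b. h (a + b) = h a + h b" and "inj h"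
    and "m \<in> Poly_Mapping.keys f" "n \<in> Poly_Mapping.keys g"
    and extreme: "(\<forall>a\<in>Poly_Mapping.keys f. h a \<le> h m) \<and> (\<forall>b\<in>Poly_Mapping.keys g. h b \<le> h n) \<or>
      (\<forall>a\<in>Poly_Mapping.keys f. h m \<le> h a) \<and> (\<forall>b\<in>Poly_Mapping.keys g. h n \<le> h b)"
  shows "m + n \<in> Poly_Mapping.keys (f * g)"
proof (rule add_in_keys_mult[OF assms(3,4)])
  fix a b assume ab: "a \<in> Poly_Mapping.keys f" "b \<in> Poly_Mapping.keys g" "a + b = m + n"
  then have eq: "h a + h b = h m + h n"
    by (simp flip: add)
  have "h a = h m \<and> h b = h n"
    using extreme
  proof
    assume "(\<forall>a\<in>Poly_Mapping.keys f. h a \<le> h m) \<and> (\<forall>b\<in>Poly_Mapping.keys g. h b \<le> h n)"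
    with ab(1,2) have "h a \<le> h m" "h b \<le> h n" by auto
    with eq show ?thesis
      by (metis add_le_less_mono add_less_le_mono less_irrefl order_le_less)
  next
    assume "(\<forall>a\<in>Poly_Mapping.keys f. h m \<le> h a) \<and> (\<forall>b\<in>Poly_Mapping.keys g. h n \<le> h b)"
    with ab(1,2) have "h m \<le> h a" "h n \<le> h b" by auto
    with eq show ?thesis
      by (metis add_le_less_mono add_less_le_mono less_irrefl order_le_less)
  qed
  with \<open>inj h\<close> show "a = m \<and> b = n"
    by (auto dest: injD)
qed

section \<open>A graded monomial order and homogeneous factors\<close>

text \<open>
  The order on \<open>nat \<Rightarrow>\<^sub>0 nat\<close> is lexicographic with the smallest index first, so storing the
  degree at index \<open>0\<close> makes the pulled back monomial order a graded one.
\<close>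

definition graded_lex :: "('n::finite \<Rightarrow>\<^sub>0 nat) \<Rightarrow> (nat \<Rightarrow>\<^sub>0 nat)" where
  "graded_lex m = Poly_Mapping.single 0 (mon_degree m) +
     (\<Sum>j\<in>UNIV. Poly_Mapping.single (Suc (to_nat j)) (Poly_Mapping.lookup m j))"

lemma mon_degree_add: "mon_degree (a + b) = mon_degree a + mon_degree b"
  by (simp add: mon_degree_def lookup_add sum.distrib)

lemma mon_degree_single [simp]: "mon_degree (Poly_Mapping.single i k) = k"
  by (simp add: mon_degree_def lookup_single when_def)

lemma mon_degree_eq_0_iff: "mon_degree m = 0 \<longleftrightarrow> m = 0"
  by (auto simp: mon_degree_def intro: poly_mapping_eqI)

lemma graded_lex_add: "graded_lex (a + b) = graded_lex a + graded_lex b"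
  by (simp add: graded_lex_def mon_degree_add single_add lookup_add sum.distrib algebra_simps)

lemma lookup_graded_lex:
  "Poly_Mapping.lookup (graded_lex m) 0 = mon_degree m"
  "Poly_Mapping.lookup (graded_lex m) (Suc (to_nat j)) = Poly_Mapping.lookup m j"
proof -
  show "Poly_Mapping.lookup (graded_lex m) 0 = mon_degree m"
    by (simp add: graded_lex_def lookup_add lookup_sum lookup_single)
  have "Poly_Mapping.lookup (graded_lex m) (Suc (to_nat j)) =
      (\<Sum>i\<in>UNIV. if i = j then Poly_Mapping.lookup m i else 0)"
    by (auto simp: graded_lex_def lookup_add lookup_sum lookup_single when_def intro!: sum.cong)
  then show "Poly_Mapping.lookup (graded_lex m) (Suc (to_nat j)) = Poly_Mapping.lookup m j"
    by simp
qed

lemma inj_graded_lex: "inj graded_lex"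
  by (metis injI lookup_graded_lex(2) poly_mapping_eqI)

lemma mon_degree_mono:
  assumes "graded_lex m \<le> graded_lex n"
  shows "mon_degree m \<le> mon_degree n"
proof -
  have "Poly_Mapping.lookup p 0 \<le> Poly_Mapping.lookup q 0" if "p \<le> q" for p q :: "nat \<Rightarrow>\<^sub>0 nat"
    \<comment> \<open>At the first index where \<open>p\<close> and \<open>q\<close> differ,
      \<open>p\<close> is smaller. If that index is positive, the entries at \<open>0\<close>
      agree.\<close>
    using that by transfer (auto simp: less_fun_def, metis bot_nat_0.not_eq_extremum less_imp_le order_refl)
  from this[OF assms] show ?thesis
    by (simp add: lookup_graded_lex)
qed

text \<open>The sum of the smallest keys and the sum of the largest keys both survive in the
  product, so both have degree \<open>d\<close>. Since the order is graded, these keys also bound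
  the degrees within each factor, and the two ranges of degrees shrink to a point.\<close>

lemma homogeneous_factors:
  fixes f g :: "('n::finite, 'k::field) mpoly"
  assumes "f * g \<noteq> 0" and hom: "\<And>m. m \<in> Poly_Mapping.keys (f * g) \<Longrightarrow> mon_degree m = d"
  obtains a b where "a + b = d" "\<And>m. m \<in> Poly_Mapping.keys f \<Longrightarrow> mon_degree m = a"
    "\<And>m. m \<in> Poly_Mapping.keys g \<Longrightarrow> mon_degree m = b"
proof -
  have "f \<noteq> 0" "g \<noteq> 0"
    using assms(1) by auto
  obtain m m' where m: "m \<in> Poly_Mapping.keys f" "m' \<in> Poly_Mapping.keys f"
      "\<And>a. a \<in> Poly_Mapping.keys f \<Longrightarrow> graded_lex m \<le> graded_lex a \<and> graded_lex a \<le> graded_lex m'"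
    using ordered_extreme_key[OF \<open>f \<noteq> 0\<close>, of graded_lex] by metis
  obtain n n' where n: "n \<in> Poly_Mapping.keys g" "n' \<in> Poly_Mapping.keys g"
      "\<And>a. a \<in> Poly_Mapping.keys g \<Longrightarrow> graded_lex n \<le> graded_lex a \<and> graded_lex a \<le> graded_lex n'"
    using ordered_extreme_key[OF \<open>g \<noteq> 0\<close>, of graded_lex] by metis
  have "m + n \<in> Poly_Mapping.keys (f * g)" "m' + n' \<in> Poly_Mapping.keys (f * g)"
    using m n by (auto intro!: keys_mult_extreme[OF graded_lex_add inj_graded_lex])
  then have low: "mon_degree m + mon_degree n = d" and high: "mon_degree m' + mon_degree n' = d"
    using hom by (auto simp flip: mon_degree_add)
  have m_le: "mon_degree m \<le> mon_degree a \<and> mon_degree a \<le> mon_degree m'" if "a \<in> Poly_Mapping.keys f" for a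
    using m(3)[OF that] by (auto intro: mon_degree_mono)
  have n_le: "mon_degree n \<le> mon_degree a \<and> mon_degree a \<le> mon_degree n'" if "a \<in> Poly_Mapping.keys g" for a
    using n(3)[OF that] by (auto intro: mon_degree_mono)
  have "mon_degree m = mon_degree m'" "mon_degree n = mon_degree n'"
    using m_le[OF m(2)] n_le[OF n(2)] low high by linarith+
  with low m_le n_le show thesis
    by (intro that[of "mon_degree m" "mon_degree n"]) (auto intro: antisym)
qed

lemma degree_0_unit:
  fixes f :: "('n::finite, 'k::field) mpoly"
  assumes "f \<noteq> 0" "\<And>m. m \<in> Poly_Mapping.keys f \<Longrightarrow> mon_degree m = 0"
  shows "f dvd 1"
proof -
  have "Poly_Mapping.keys f \<subseteq> {0}"
    using assms(2) by (auto simp: mon_degree_eq_0_iff)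
  then have f: "f = Poly_Mapping.single 0 (Poly_Mapping.lookup f 0)"
    by (intro poly_mapping_eqI) (auto simp: lookup_single when_def in_keys_iff)
  with assms(1) have "Poly_Mapping.lookup f 0 \<noteq> 0"
    by (metis single_zero)
  then have "f * Poly_Mapping.single 0 (inverse (Poly_Mapping.lookup f 0)) = 1"
    by (subst f) (simp add: mult_single)
  then show ?thesis
    by (metis dvdI)
qed

section \<open>Monomials of degree one and two\<close>

text \<open>The exponent vector of the variable \<open>x_j\<close>, as opposed to the polynomial
  \<open>mvar j\<close>. Products of variables become sums of such vectors.\<close>

definition X :: "'n \<Rightarrow> ('n \<Rightarrow>\<^sub>0 nat)" where
  "X j = Poly_Mapping.single j 1"

lemma lookup_X: "Poly_Mapping.lookup (X j) i = (if i = j then 1 else 0)"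
  by (simp add: X_def lookup_single when_def)

lemma mon_degree_X [simp]: "mon_degree (X j) = 1"
  by (simp add: X_def)

lemma mon_degree_1:
  assumes "mon_degree m = 1"
  obtains j where "m = X j"
proof -
  from assms obtain j where "Poly_Mapping.lookup m j \<noteq> 0"
    by (metis mon_degree_eq_0_iff lookup_zero poly_mapping_eqI zero_neq_one)
  \<comment> \<open>Subtraction of exponents is truncated; adding \<open>X j\<close> back recovers
    \<open>m\<close> because \<open>j\<close> occurs in \<open>m\<close>.\<close>
  then have m: "m = X j + (m - X j)"
    by (intro poly_mapping_eqI) (auto simp: lookup_add lookup_minus lookup_X)
  then have "mon_degree (m - X j) = 0"
    using assms mon_degree_add[of "X j" "m - X j"] by simp
  with m show thesis
    by (intro that[of j]) (simp add: mon_degree_eq_0_iff)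
qed

lemma mon_degree_2:
  assumes "mon_degree m = 2"
  obtains i j where "m = X i + X j"
proof -
  from assms obtain j where "Poly_Mapping.lookup m j \<noteq> 0"
    by (metis mon_degree_eq_0_iff lookup_zero poly_mapping_eqI zero_neq_numeral)
  then have m: "m = X j + (m - X j)"
    by (intro poly_mapping_eqI) (auto simp: lookup_add lookup_minus lookup_X)
  then have "mon_degree (m - X j) = 1"
    using assms mon_degree_add[of "X j" "m - X j"] by simp
  then obtain i where "m - X j = X i"
    by (rule mon_degree_1)
  with m that show thesis
    by metis
qed

lemma X_inject [simp]: "X i = X j \<longleftrightarrow> i = j"
  by (metis lookup_X zero_neq_one)

lemma X_add_X_eq_iff: "X i + X j = X k + X l \<longleftrightarrow> i = k \<and> j = l \<or> i = l \<and> j = k"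
proof
  assume eq: "X i + X j = X k + X l"
  then have "Poly_Mapping.lookup (X i + X j) i = Poly_Mapping.lookup (X k + X l) i"
    by simp
  then have "i = k \<or> i = l"
    by (simp add: lookup_add lookup_X split: if_splits)
  with eq show "i = k \<and> j = l \<or> i = l \<and> j = k"
    by (metis X_inject add.commute add_left_cancel)
qed (auto simp: add.commute)

section \<open>Irreducibility of quadratic binomials\<close>

text \<open>The monomial \<open>X i + X j\<close> comes from the ordered pairs \<open>(i, j)\<close>
  and \<open>(j, i)\<close>. They coincide for a square, which therefore has a single term and needs
  its own case.\<close>

lemma lookup_mult_linear_forms:
  fixes f g :: "('n::finite, 'k::field) mpoly"
  assumes f: "\<And>m. m \<in> Poly_Mapping.keys f \<Longrightarrow> mon_degree m = 1" and g: "\<And>m. m \<in> Poly_Mapping.keys g \<Longrightarrow> mon_degree m = 1"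
  shows "Poly_Mapping.lookup (f * g) (X i + X j) = (if i = j then Poly_Mapping.lookup f (X i) * Poly_Mapping.lookup g (X i)
    else Poly_Mapping.lookup f (X i) * Poly_Mapping.lookup g (X j) + Poly_Mapping.lookup f (X j) * Poly_Mapping.lookup g (X i))"
proof -
  have linear: "p = (\<Sum>i\<in>UNIV. Poly_Mapping.single (X i) (Poly_Mapping.lookup p (X i)))"
    if p: "\<And>m. m \<in> Poly_Mapping.keys p \<Longrightarrow> mon_degree m = 1" for p :: "('n, 'k) mpoly"
  proof (rule poly_mapping_eqI)
    fix m
    show "Poly_Mapping.lookup p m = Poly_Mapping.lookup (\<Sum>i\<in>UNIV. Poly_Mapping.single (X i) (Poly_Mapping.lookup p (X i))) m"
    proof (cases "\<exists>i. m = X i")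
      case True
      then obtain i where "m = X i" ..
      then show ?thesis
        by (simp add: lookup_sum lookup_single when_def)
    next
      case False
      then have "m \<notin> Poly_Mapping.keys p"
        using p mon_degree_1 by metis
      with False show ?thesis
        using eq_commute[of m] by (simp add: lookup_sum lookup_single in_keys_iff)
    qed
  qed
  have "f * g = (\<Sum>p\<in>UNIV. \<Sum>q\<in>UNIV. Poly_Mapping.single (X p + X q) (Poly_Mapping.lookup f (X p) * Poly_Mapping.lookup g (X q)))"
    by (subst (1) linear[OF f], assumption, subst (1) linear[OF g], assumption)
      (simp add: sum_product mult_single)
  then have "Poly_Mapping.lookup (f * g) (X i + X j) =
      (\<Sum>p\<in>UNIV. \<Sum>q\<in>UNIV. Poly_Mapping.lookup f (X p) * Poly_Mapping.lookup g (X q) when X p + X q = X i + X j)"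
    by (simp add: lookup_sum lookup_single)
  \<comment> \<open>The test \<open>i = j\<close> in the second summand keeps the diagonal pair from
    being counted twice.\<close>
  also have "\<dots> = (\<Sum>p\<in>UNIV. \<Sum>q\<in>UNIV. (if q = j then if p = i then Poly_Mapping.lookup f (X i) * Poly_Mapping.lookup g (X j) else 0 else 0)
      + (if q = i then if p = j then if i = j then 0 else Poly_Mapping.lookup f (X j) * Poly_Mapping.lookup g (X i) else 0 else 0))"
    by (intro sum.cong refl) (auto simp: X_add_X_eq_iff when_def)
  also have "\<dots> = (if i = j then Poly_Mapping.lookup f (X i) * Poly_Mapping.lookup g (X i)
    else Poly_Mapping.lookup f (X i) * Poly_Mapping.lookup g (X j) + Poly_Mapping.lookup f (X j) * Poly_Mapping.lookup g (X i))"
    by (simp add: sum.distrib)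
  finally show ?thesis .
qed

text \<open>Here \<open>c s t\<close> is the coefficient of \<open>x_s x_t\<close> in the product of
  the linear forms with coefficients \<alpha> and \<beta>. Since \<open>x_i^2\<close> is absent, one
  form omits \<open>x_i\<close>, and the other contains it because \<open>x_i x_j\<close> is
  present. As \<open>x_i x_k\<close> and \<open>x_i x_l\<close> are absent, the form omitting
  \<open>x_i\<close> also omits \<open>x_k\<close> and \<open>x_l\<close>, so \<open>x_k x_l\<close>
  cannot appear.\<close>

lemma linear_factors_coefficient:
  fixes \<alpha> \<beta> :: "'n \<Rightarrow> 'k::field"
  defines "c \<equiv> \<lambda>s t. if s = t then \<alpha> s * \<beta> s else \<alpha> s * \<beta> t + \<alpha> t * \<beta> s"
  assumes "i \<noteq> j" "c i i = 0" "c j j = 0" "c i j \<noteq> 0" "c i k = 0" "c i l = 0"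
  shows "c k l = 0"
proof (cases "\<alpha> i = 0")
  case True
  with assms have "\<alpha> j \<noteq> 0" "\<beta> i \<noteq> 0" by auto
  with True assms have "\<alpha> k = 0" "\<alpha> l = 0" by (auto split: if_splits)
  then show ?thesis by (simp add: c_def)
next
  case False
  with assms have "\<beta> i = 0" by auto
  with False assms have "\<beta> k = 0" "\<beta> l = 0" by (auto split: if_splits)
  then show ?thesis by (simp add: c_def)
qed

text \<open>Both factors are homogeneous with degrees adding up to 2, so either one is a nonzero
  constant or both are linear forms. In the linear case the presence of the non-square monomial
  forces the coefficient of the other one to vanish. Arbitrary nonzero coefficients keep the two
  monomials interchangeable.\<close>

lemma irreducible_quadratic_binomial:
  fixes c d :: "'k::field"
  assumes "c \<noteq> 0" "d \<noteq> 0" and "{i, j} \<inter> {k, l} = {}" and "i \<noteq> j \<or> k \<noteq> l"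
  shows "irreducible (Poly_Mapping.single (X i + X j) c + Poly_Mapping.single (X k + X l) d :: ('n::finite, 'k) mpoly)"
    (is "irreducible ?p")
proof -
  have look: "Poly_Mapping.lookup ?p m = (if m = X i + X j then c else if m = X k + X l then d else 0)" for m
    using assms(3) by (auto simp: lookup_add lookup_single when_def X_add_X_eq_iff)
  have ne: "?p \<noteq> 0"
    using look[of "X i + X j"] \<open>c \<noteq> 0\<close> by auto
  have hom: "mon_degree m = 2" if "m \<in> Poly_Mapping.keys ?p" for m
    using that by (auto simp: in_keys_iff look mon_degree_add split: if_splits)
  show ?thesis
  proof (rule irreducibleI)
    show "?p \<noteq> 0" by (rule ne)
  next
    show "\<not> ?p dvd 1"
    proof
      assume "?p dvd 1"
      then obtain q where q: "?p * q = 1"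
        by (metis dvdE)
      \<comment> \<open>The product 1 is homogeneous of degree 0, so a divisor of 1 would have
        degree 0 as well.\<close>
      obtain a b where "a + b = 0" "\<And>m. m \<in> Poly_Mapping.keys ?p \<Longrightarrow> mon_degree m = a"
        by (rule homogeneous_factors[of ?p q 0]) (auto simp: q mon_degree_eq_0_iff)
      then show False
        using hom[of "X i + X j"] \<open>c \<noteq> 0\<close> by (force simp: in_keys_iff look)
    qed
  next
    fix f g assume fg: "?p = f * g"
    obtain a b where ab: "a + b = 2" "\<And>m. m \<in> Poly_Mapping.keys f \<Longrightarrow> mon_degree m = a"
        "\<And>m. m \<in> Poly_Mapping.keys g \<Longrightarrow> mon_degree m = b"
      by (rule homogeneous_factors[of f g 2]) (use ne hom in \<open>auto simp: fg\<close>)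
    have "f \<noteq> 0" "g \<noteq> 0"
      using ne fg by auto
    consider "a = 0" | "b = 0" | "a = 1" "b = 1"
      using ab(1) by linarith
    then show "f dvd 1 \<or> g dvd 1"
    proof cases
      case 1
      with ab \<open>f \<noteq> 0\<close> show ?thesis by (auto intro: degree_0_unit)
    next
      case 2
      with ab \<open>g \<noteq> 0\<close> show ?thesis by (auto intro: degree_0_unit)
    next
      case 3
      define \<alpha> \<beta> where "\<alpha> s = Poly_Mapping.lookup f (X s)" and "\<beta> s = Poly_Mapping.lookup g (X s)" for s
      have coeff: "(if s = t then \<alpha> s * \<beta> s else \<alpha> s * \<beta> t + \<alpha> t * \<beta> s) =
          (if X s + X t = X i + X j then c else if X s + X t = X k + X l then d else 0)" for s t
        using lookup_mult_linear_forms[of f g s t] ab(2,3) 3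
        by (simp add: \<alpha>_def \<beta>_def look flip: fg)
      have False
      proof (cases "i = j")
        case True
        with assms(4) have "k \<noteq> l" by simp
        \<comment> \<open>With \<open>i = j\<close> the non-square monomial is the second one, so
          the two pairs swap roles.\<close>
        from linear_factors_coefficient[OF this, of \<alpha> \<beta> i j, unfolded coeff] True show False
          using assms(1-3) \<open>k \<noteq> l\<close> by (auto simp: X_add_X_eq_iff)
      next
        case False
        from linear_factors_coefficient[OF this, of \<alpha> \<beta> k l, unfolded coeff] show False
          using assms(1-3) False by (auto simp: X_add_X_eq_iff)
      qed
      then show ?thesis ..
    qed
  qed
qed

section \<open>Affine dependencies between points with entries in a narrow range\<close>

text \<open>The dependency puts \<open>p\<close>, \<open>q\<close> and \<open>r\<close> on a line,
  and no coefficient can vanish since the points are distinct. A coordinate separating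
  \<open>p\<close> from \<open>r\<close> thus separates all three, and there the range forces
  \<open>r\<close> to be the midpoint of \<open>p\<close> and \<open>q\<close>. The ratio of the
  coefficients is then fixed, so \<open>r\<close> is the midpoint in every coordinate and equals
  \<open>s\<close>.\<close>

lemma window_dependency_False:
  fixes p q r s :: "'d \<Rightarrow> int" and a b c :: int
  assumes dep: "a + b + c = 0" "\<And>i. a * p i + b * q i + c * r i = 0" "a \<noteq> 0 \<or> b \<noteq> 0 \<or> c \<noteq> 0"
    and s: "\<And>i. p i + q i = r i + s i"
    and distinct: "p \<noteq> q" "p \<noteq> r" "q \<noteq> r" "r \<noteq> s"
    and window: "\<And>i. \<exists>z. \<forall>x\<in>{p i, q i, r i, s i}. z - 1 \<le> x \<and> x \<le> z + 1"
  shows False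
proof -
  have c: "c = - a - b"
    using dep(1) by simp
  have line: "b * (q i - r i) = - a * (p i - r i)" for i
    using dep(2)[of i] unfolding c by (simp add: algebra_simps)
  obtain i where pr: "p i \<noteq> r i"
    using \<open>p \<noteq> r\<close> by auto
  have "b \<noteq> 0"
    using line[of i] pr dep(3) c by auto
  have "a \<noteq> 0"
    using line \<open>b \<noteq> 0\<close> \<open>q \<noteq> r\<close> by (auto simp: fun_eq_iff)
  \<comment> \<open>This is the coefficient \<open>c\<close> up to sign; if it vanished,
    \<open>p\<close> and \<open>q\<close> would coincide.\<close>
  have "a + b \<noteq> 0"
  proof
    assume "a + b = 0"
    then have "b * (q i - r i) = b * (p i - r i)" for i
      using line[of i] by (simp add: add_eq_0_iff2)
    with \<open>b \<noteq> 0\<close> \<open>p \<noteq> q\<close> show False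
      by (auto simp: fun_eq_iff)
  qed
  have "q i \<noteq> r i"
    using line[of i] pr \<open>a \<noteq> 0\<close> by auto
  moreover have "q i \<noteq> p i"
  proof
    assume "q i = p i"
    with line[of i] have "(a + b) * (p i - r i) = 0"
      by (simp add: algebra_simps)
    with \<open>a + b \<noteq> 0\<close> pr show False by simp
  qed
  moreover obtain z where "\<forall>x\<in>{p i, q i, r i, s i}. z - 1 \<le> x \<and> x \<le> z + 1"
    using window by blast
  \<comment> \<open>Three distinct values fill the three available places. If \<open>r i\<close>
    were the lowest or the highest, \<open>s i = p i + q i - r i\<close> would leave the range, so
    it is the middle one.\<close>
  ultimately have mid: "q i - r i = - (p i - r i)"
    using pr s[of i] by auto
  have "(a - b) * (p i - r i) = 0"
    using line[of i] unfolding mid by (simp add: algebra_simps)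
  with pr have "a = b"
    by simp
  \<comment> \<open>Equal coefficients cancel from \<open>line\<close>, which carries the midpoint
    property from one coordinate to all of them.\<close>
  with line \<open>b \<noteq> 0\<close> have "q i - r i = - (p i - r i)" for i
    by (metis mult_cancel_left mult_minus_left mult_minus_right)
  with s have "r i = s i" for i
    by (smt (verit))
  with \<open>r \<noteq> s\<close> show False
    by auto
qed

section \<open>Binomials of the toric ideal as integer relations\<close>

text \<open>The exponent on the right is the product of the matrix \<open>A\<close> with the
  exponent vector \<open>u\<close>.\<close>

lemma toric_map_mon:
  fixes A :: "int ^ 'n ^ 'd::finite"
  shows "toric_map A (mon u :: ('n::finite, 'k::field) mpoly) =
    lmon (\<chi> i. \<Sum>j\<in>UNIV. int (Poly_Mapping.lookup u j) * A $ i $ j)"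
proof -
  have pow: "lmon a ^ k = (lmon (\<chi> i. int k * a $ i) :: ('d, 'k) laurent)" for a :: "int ^ 'd" and k
    by (induction k) (auto simp: lmon_zero[symmetric] zero_vec_def vec_eq_iff distrib_right
      simp flip: lmon_add intro!: arg_cong[where f=lmon])
  have prd: "(\<Prod>j\<in>J. lmon (a j)) = (lmon (\<Sum>j\<in>J. a j) :: ('d, 'k) laurent)" if "finite J" for a :: "'n \<Rightarrow> int ^ 'd" and J
    using that by (induction J rule: finite_induct) (auto simp: lmon_zero lmon_add)
  show ?thesis
    by (auto simp: mon_def toric_map_single pow prd column_def vec_eq_iff intro!: arg_cong[where f=lmon])
qed

text \<open>A Laurent monomial determines its exponent vector, so membership says that
  \<open>u - v\<close>, taken over the integers, lies in the kernel of \<open>A\<close>.\<close>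

lemma mon_diff_in_toric_ideal_iff:
  fixes A :: "int ^ 'n ^ 'd::finite"
  shows "(mon u - mon v :: ('n::finite, 'k::field) mpoly) \<in> toric_ideal A \<longleftrightarrow>
    (\<forall>i. (\<Sum>j\<in>UNIV. (int (Poly_Mapping.lookup u j) - int (Poly_Mapping.lookup v j)) * A $ i $ j) = 0)"
proof -
  have "toric_map A (mon u :: ('n, 'k) mpoly) = toric_map A (mon u - mon v) + toric_map A (mon v)"
    by (simp flip: toric_map_add)
  then have "(mon u - mon v :: ('n, 'k) mpoly) \<in> toric_ideal A \<longleftrightarrow>
      toric_map A (mon u :: ('n, 'k) mpoly) = toric_map A (mon v)"
    by (simp add: toric_ideal_def)
  moreover have "lmon a = (lmon b :: ('d, 'k) laurent) \<longleftrightarrow> a = b" for a b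
    by (metis lmon_def lookup_single_eq lookup_single_not_eq zero_neq_one)
  ultimately show ?thesis
    by (simp add: toric_map_mon vec_eq_iff left_diff_distrib sum_subtractf)
qed

text \<open>Pairing the relation with the normal vector \<open>w\<close> of the hyperplane gives
  \<open>c\<close> times the sum of \<delta>, and \<open>c\<close> is nonzero because the hyperplane
  misses the origin. Linear relations between columns are therefore affine ones.\<close>

lemma configuration_sum_zero:
  fixes A :: "int ^ 'n ^ 'd" and \<delta> :: "'n::finite \<Rightarrow> int"
  assumes "configuration A" and "\<And>i. (\<Sum>j\<in>UNIV. \<delta> j * A $ i $ j) = 0"
  shows "(\<Sum>j\<in>UNIV. \<delta> j) = 0"
proof -
  obtain w :: "real ^ 'd" and c where "c \<noteq> 0"
    and w: "\<And>j. w \<bullet> (\<chi> i. real_of_int (A $ i $ j)) = c"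
    using assms(1) unfolding configuration_def by auto
  have "c * real_of_int (\<Sum>j\<in>UNIV. \<delta> j) = (\<Sum>j\<in>UNIV. \<Sum>i\<in>UNIV. w $ i * (real_of_int (\<delta> j) * real_of_int (A $ i $ j)))"
    unfolding of_int_sum sum_distrib_left
  proof (rule sum.cong[OF refl])
    fix j
    show "c * real_of_int (\<delta> j) = (\<Sum>i\<in>UNIV. w $ i * (real_of_int (\<delta> j) * real_of_int (A $ i $ j)))"
      by (simp add: inner_vec_def sum_distrib_left sum_distrib_right mult_ac flip: w[of j])
  qed
  also have "\<dots> = (\<Sum>i\<in>UNIV. w $ i * real_of_int (\<Sum>j\<in>UNIV. \<delta> j * A $ i $ j))"
    by (subst sum.swap) (simp add: sum_distrib_left)
  finally show ?thesis
    using \<open>c \<noteq> 0\<close> assms(2) by (simp del: of_int_sum)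
qed

text \<open>Dropping \<open>l\<close> leaves at most three columns. If one monomial is a square,
  only two remain, and distinct columns admit no dependency; otherwise three collinear columns
  contradict the bound on the entries.\<close>

lemma dependency_zero:
  fixes A :: "int ^ 'n ^ 'd" and \<delta> :: "'n::finite \<Rightarrow> int"
  assumes distinct: "\<And>j k. j \<noteq> k \<Longrightarrow> column j A \<noteq> column k A"
    and window: "\<And>r. \<exists>z. \<forall>j. z - 1 \<le> A $ r $ j \<and> A $ r $ j \<le> z + 1"
    and rel: "\<And>r. A $ r $ i + A $ r $ j = A $ r $ k + A $ r $ l"
    and disj: "{i, j} \<inter> {k, l} = {}"
    and \<delta>: "(\<Sum>t\<in>UNIV. \<delta> t) = 0" "\<And>r. (\<Sum>t\<in>UNIV. \<delta> t * A $ r $ t) = 0"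
    and supp: "{t. \<delta> t \<noteq> 0} \<subseteq> {i, j, k, l} - {l}"
  shows "\<delta> t = 0"
proof -
  have column_eq: "t = t'" if "\<And>r. A $ r $ t = A $ r $ t'" for t t'
    using distinct[of t t'] that by (auto simp: column_def vec_eq_iff)
  have restrict: "(\<Sum>t\<in>T. \<delta> t) = 0 \<and> (\<forall>r. (\<Sum>t\<in>T. \<delta> t * A $ r $ t) = 0)"
    if "{t. \<delta> t \<noteq> 0} \<subseteq> T" for T
  proof -
    have "(\<Sum>t\<in>T. \<delta> t * x t) = (\<Sum>t\<in>UNIV. \<delta> t * x t)" for x
      using that by (intro sum.mono_neutral_left) auto
    \<comment> \<open>The constant function 1 yields the plain sum of \<delta>, the rows of
      \<open>A\<close> the weighted sums.\<close>
    from this[of "\<lambda>_. 1"] this show ?thesis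
      using \<delta> by simp
  qed
  \<comment> \<open>A dependency on two columns is a multiple of their difference, which is nonzero
    in some row.\<close>
  have pair: "\<delta> t = 0" if T: "{t. \<delta> t \<noteq> 0} \<subseteq> {p, q}" for p q
  proof (cases "p = q")
    case True
    with restrict[OF T] T show ?thesis by auto
  next
    case False
    with restrict[OF T] have *: "\<delta> q = - \<delta> p" "\<And>r. \<delta> p * A $ r $ p + \<delta> q * A $ r $ q = 0"
      by auto
    then have "\<delta> p * (A $ r $ p - A $ r $ q) = 0" for r
      by (metis add_uminus_conv_diff mult_minus_left right_diff_distrib)
    then have "\<delta> p = 0"
      using column_eq[of p q] False by auto
    with * T show ?thesis by auto
  qed
  show ?thesis
  proof (cases "i = j \<or> k = l")
    case True
    then show ?thesis
    proof
      assume "i = j"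
      with supp show ?thesis by (intro pair[of i k]) auto
    next
      assume "k = l"
      with supp show ?thesis by (intro pair[of i j]) auto
    qed
  next
    case False
    have T: "{t. \<delta> t \<noteq> 0} \<subseteq> {i, j, k}"
      using supp by auto
    have dep: "\<delta> i + \<delta> j + \<delta> k = 0" "\<And>r. \<delta> i * A $ r $ i + \<delta> j * A $ r $ j + \<delta> k * A $ r $ k = 0"
      using restrict[OF T] disj False by (auto simp: add.assoc)
    have "\<not> (\<delta> i \<noteq> 0 \<or> \<delta> j \<noteq> 0 \<or> \<delta> k \<noteq> 0)"
    proof
      assume nz: "\<delta> i \<noteq> 0 \<or> \<delta> j \<noteq> 0 \<or> \<delta> k \<noteq> 0"
      have "(\<lambda>r. A $ r $ x) \<noteq> (\<lambda>r. A $ r $ y)" if "x \<noteq> y" for x y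
        using column_eq[of x y] that by (metis (mono_tags))
      moreover have "\<exists>z. \<forall>x\<in>{A $ r $ i, A $ r $ j, A $ r $ k, A $ r $ l}. z - 1 \<le> x \<and> x \<le> z + 1" for r
        using window[of r] by auto
      ultimately show False
        using window_dependency_False[where p="\<lambda>r. A $ r $ i" and q="\<lambda>r. A $ r $ j"
            and r="\<lambda>r. A $ r $ k" and s="\<lambda>r. A $ r $ l", OF dep nz rel] disj False by auto
    qed
    with T show ?thesis by auto
  qed
qed

section \<open>Quadratic binomials as circuits\<close>

text \<open>A shared variable would cancel from the relation between the columns, leaving two equal
  columns and hence equal monomials. Two squares would give \<open>2 a_i = 2 a_k\<close> and so
  \<open>i = k\<close>.\<close>

lemma quadratic_toric_binomial:
  fixes A :: "int ^ 'n ^ 'd" and f :: "('n, 'k::field) mpoly"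
  assumes distinct: "\<And>j k. j \<noteq> k \<Longrightarrow> column j A \<noteq> column k A"
    and "f \<in> toric_ideal A" "quadratic_binomial f"
  obtains i j k l where "f = mon (X i + X j) - mon (X k + X l)" "{i, j} \<inter> {k, l} = {}"
    "i \<noteq> j \<or> k \<noteq> l" "\<And>r. A $ r $ i + A $ r $ j = A $ r $ k + A $ r $ l"
proof -
  obtain u v where uv: "u \<noteq> v" "mon_degree u = 2" "mon_degree v = 2" "f = mon u - mon v"
    using assms(3) unfolding quadratic_binomial_def by blast
  obtain i j k l where u: "u = X i + X j" and v: "v = X k + X l"
    using uv(2,3) mon_degree_2 by metis
  have "(\<Sum>t\<in>UNIV. (int (Poly_Mapping.lookup u t) - int (Poly_Mapping.lookup v t)) * A $ r $ t) = 0" for r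
    using assms(2) unfolding uv(4) mon_diff_in_toric_ideal_iff by blast
  moreover have "(\<Sum>t\<in>UNIV. int (Poly_Mapping.lookup (X p) t) * A $ r $ t) = A $ r $ p" for p r
  proof -
    have "(\<Sum>t\<in>UNIV. int (Poly_Mapping.lookup (X p) t) * A $ r $ t) = (\<Sum>t\<in>UNIV. if t = p then A $ r $ t else 0)"
      by (rule sum.cong) (auto simp: lookup_X)
    then show ?thesis by simp
  qed
  ultimately have rel: "A $ r $ i + A $ r $ j = A $ r $ k + A $ r $ l" for r
    by (simp add: u v lookup_add left_diff_distrib distrib_right sum_subtractf sum.distrib)
  have column_eq: "t = t'" if "\<And>r. A $ r $ t = A $ r $ t'" for t t'
    using distinct[of t t'] that by (auto simp: column_def vec_eq_iff)
  have ne: "\<not> (i = k \<and> j = l \<or> i = l \<and> j = k)"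
    using uv(1) by (simp add: u v X_add_X_eq_iff)
  have "{i, j} \<inter> {k, l} = {}"
  proof (rule ccontr)
    assume "{i, j} \<inter> {k, l} \<noteq> {}"
    then consider "i = k" | "i = l" | "j = k" | "j = l" by auto
    then show False
      using ne rel column_eq[of j l] column_eq[of j k] column_eq[of i l] column_eq[of i k]
      by cases (auto simp: add.commute)
  qed
  moreover have "i \<noteq> j \<or> k \<noteq> l"
    using rel column_eq[of i k] ne by auto
  ultimately show thesis
    using that rel uv(4) by (simp add: u v)
qed

text \<open>A binomial of smaller support omits a variable of \<open>f\<close>. The difference of
  its exponents is then an affine dependency between the remaining columns, hence zero, and its two
  monomials coincide.\<close>

lemma quadratic_toric_binomial_in_circuits:
  fixes A :: "int ^ 'n ^ 'd" and f :: "('n, 'k::field) mpoly"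
  assumes "configuration A"
    and distinct: "\<And>j k. j \<noteq> k \<Longrightarrow> column j A \<noteq> column k A"
    and window: "\<And>r. \<exists>z. \<forall>j. z - 1 \<le> A $ r $ j \<and> A $ r $ j \<le> z + 1"
    and f: "f \<in> toric_ideal A" and f_eq: "f = mon (X i + X j) - mon (X k + X l)"
    and disj: "{i, j} \<inter> {k, l} = {}" and sf: "i \<noteq> j \<or> k \<noteq> l"
    and rel: "\<And>r. A $ r $ i + A $ r $ j = A $ r $ k + A $ r $ l"
  shows "f \<in> circuits A"
proof -
  have ne: "X i + X j \<noteq> X k + X l"
    using disj by (auto simp: X_add_X_eq_iff)
  have "f = Poly_Mapping.single (X i + X j) 1 + Poly_Mapping.single (X k + X l) (- 1)"
    by (simp add: f_eq mon_def single_uminus)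
  moreover have "irreducible \<dots>"
    using disj sf by (intro irreducible_quadratic_binomial) simp_all
  ultimately have "irreducible f"
    by (simp only:)
  moreover have "\<not> supp g \<subset> supp f" if g: "g \<in> toric_ideal A" "is_binomial g" for g :: "('n, 'k) mpoly"
  proof
    assume "supp g \<subset> supp f"
    obtain u v where uv: "u \<noteq> v" "g = mon u - mon v"
      using g(2) unfolding is_binomial_def by blast
    define \<delta> where "\<delta> t = int (Poly_Mapping.lookup u t) - int (Poly_Mapping.lookup v t)" for t
    have "Poly_Mapping.keys (X p + X q) = {p, q}" for p q :: 'n
      by (auto simp: in_keys_iff lookup_add lookup_X split: if_splits)
    then have "supp f = {i, j, k, l}"
      unfolding f_eq supp_binomial[OF ne] by auto
    moreover have "{t. \<delta> t \<noteq> 0} \<subseteq> supp g"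
      unfolding uv(2) supp_binomial[OF uv(1)] by (auto simp: \<delta>_def in_keys_iff)
    ultimately obtain s where s: "s \<in> {i, j, k, l}" and T: "{t. \<delta> t \<noteq> 0} \<subseteq> {i, j, k, l} - {s}"
      using \<open>supp g \<subset> supp f\<close> by blast
    have sums: "(\<Sum>t\<in>UNIV. \<delta> t * A $ r $ t) = 0" for r
      using g(1) unfolding uv(2) mon_diff_in_toric_ideal_iff \<delta>_def by blast
    have sum: "(\<Sum>t\<in>UNIV. \<delta> t) = 0"
      using \<open>configuration A\<close> sums by (rule configuration_sum_zero)
    note zero = dependency_zero[OF distinct window _ _ sum sums]
    \<comment> \<open>\<open>dependency_zero\<close> expects the omitted index in last place; the
      symmetries of the relation \<open>a_i + a_j = a_k + a_l\<close> bring any of the four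
      there.\<close>
    from s have "\<delta> t = 0" for t
    proof (elim insertE emptyE)
      assume "s = i" then show ?thesis
        using T by (intro zero[of k l j i]) (use rel disj in \<open>auto simp: add.commute\<close>)
    next
      assume "s = j" then show ?thesis
        using T by (intro zero[of k l i j]) (use rel disj in \<open>auto simp: add.commute\<close>)
    next
      assume "s = k" then show ?thesis
        using T by (intro zero[of i j l k]) (use rel disj in \<open>auto simp: add.commute\<close>)
    next
      assume "s = l" then show ?thesis
        using T by (intro zero[of]) (use rel disj in \<open>auto simp: add.commute\<close>)
    qed
    then have "u = v"
      by (intro poly_mapping_eqI) (simp add: \<delta>_def)
    with uv(1) show False ..
  qed
  moreover have "is_binomial f"
    using ne unfolding is_binomial_def f_eq by blast
  ultimately show ?thesis
    using f unfolding circuits_def by blast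
qed

lemma squarefree_mon_X_add_X: "squarefree_mon (X i + X j) \<longleftrightarrow> i \<noteq> j"
  by (auto simp: squarefree_mon_def lookup_add lookup_X)

theorem proposition1p1:
  fixes A :: "int ^ 'n ^ 'd"
  assumes "configuration A"
    and "\<And>j k. j \<noteq> k \<Longrightarrow> column j A \<noteq> column k A"
  shows "((\<forall>i. \<exists>z. \<forall>j. z - 1 \<le> A $ i $ j \<and> A $ i $ j \<le> z + 1) \<longrightarrow>
           (\<forall>f :: ('n, 'k::field) mpoly. f \<in> toric_ideal A \<and> quadratic_binomial f \<longrightarrow>
              f \<in> circuits_sf A)) \<and>
         ((\<forall>i. \<exists>z. \<forall>j. z \<le> A $ i $ j \<and> A $ i $ j \<le> z + 1) \<longrightarrow>
           (\<forall>f :: ('n, 'k::field) mpoly. f \<in> toric_ideal A \<and> quadratic_binomial f \<longrightarrow>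
              f \<in> circuits_sfsf A))"
proof (intro conjI impI allI; elim conjE)
  fix f :: "('n, 'k) mpoly"
  assume window: "\<forall>i. \<exists>z. \<forall>j. z - 1 \<le> A $ i $ j \<and> A $ i $ j \<le> z + 1"
    and f: "f \<in> toric_ideal A" "quadratic_binomial f"
  obtain i j k l where ijkl: "f = mon (X i + X j) - mon (X k + X l)" "{i, j} \<inter> {k, l} = {}"
    "i \<noteq> j \<or> k \<noteq> l" "\<And>r. A $ r $ i + A $ r $ j = A $ r $ k + A $ r $ l"
    using quadratic_toric_binomial[OF assms(2) f] by blast
  then have "f \<in> circuits A"
    using quadratic_toric_binomial_in_circuits[OF assms] window f by blast
  moreover have "X i + X j \<noteq> X k + X l"
    using ijkl(2) by (auto simp: X_add_X_eq_iff)
  ultimately show "f \<in> circuits_sf A"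
    using ijkl(1,3) unfolding circuits_sf_def mem_Collect_eq by (metis squarefree_mon_X_add_X)
next
  fix f :: "('n, 'k) mpoly"
  assume window: "\<forall>i. \<exists>z. \<forall>j. z \<le> A $ i $ j \<and> A $ i $ j \<le> z + 1"
    and f: "f \<in> toric_ideal A" "quadratic_binomial f"
  obtain i j k l where ijkl: "f = mon (X i + X j) - mon (X k + X l)" "{i, j} \<inter> {k, l} = {}"
    "i \<noteq> j \<or> k \<noteq> l" "\<And>r. A $ r $ i + A $ r $ j = A $ r $ k + A $ r $ l"
    using quadratic_toric_binomial[OF assms(2) f] by blast
  have "\<exists>z. \<forall>j. z - 1 \<le> A $ r $ j \<and> A $ r $ j \<le> z + 1" for r
  proof -
    obtain z where "\<forall>j. z \<le> A $ r $ j \<and> A $ r $ j \<le> z + 1"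
      using window by blast
    then show ?thesis
      \<comment> \<open>The range from \<open>z\<close> to \<open>z + 1\<close> lies in the one from
        \<open>z - 1\<close> to \<open>z + 1\<close>, so the same centre serves.\<close>
      by (intro exI[of _ z]) (auto intro: order_trans[of _ z])
  qed
  then have "f \<in> circuits A"
    using quadratic_toric_binomial_in_circuits[OF assms] f ijkl by blast
  moreover have "X i + X j \<noteq> X k + X l"
    using ijkl(2) by (auto simp: X_add_X_eq_iff)
  \<comment> \<open>In each row the entries of \<open>q\<close> and \<open>s\<close> lie in two
    consecutive integers and have an even sum, so they agree, and the entry of \<open>p\<close>
    equals them.\<close>
  moreover have midpoint: "p = q" if "\<And>r. 2 * A $ r $ p = A $ r $ q + A $ r $ s" for p q s
  proof (rule ccontr)
    assume "p \<noteq> q"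
    have "A $ r $ p = A $ r $ q" for r
    proof -
      obtain z where "\<forall>j. z \<le> A $ r $ j \<and> A $ r $ j \<le> z + 1"
        using window by blast
      then have "z \<le> A $ r $ p" "A $ r $ p \<le> z + 1" "z \<le> A $ r $ q" "A $ r $ q \<le> z + 1"
          "z \<le> A $ r $ s" "A $ r $ s \<le> z + 1"
        by auto
      with that[of r] show ?thesis by presburger
    qed
    then have "column p A = column q A"
      by (simp add: column_def)
    with assms(2) \<open>p \<noteq> q\<close> show False by blast
  qed
  \<comment> \<open>A square on either side makes its column the midpoint of the other two, so it
    would equal one of them, against the disjointness of the supports.\<close>
  have "i \<noteq> j" "k \<noteq> l"
    using midpoint[of i k l] midpoint[of k i j] ijkl(2,4) by auto
  ultimately show "f \<in> circuits_sfsf A"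
    using ijkl(1) unfolding circuits_sfsf_def mem_Collect_eq by (metis squarefree_mon_X_add_X)
qed

end
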